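(* Let $\tau^*>0$, $\tau_0>0$ and $\tau_0'<1$ be real numbers, and let the set $S_{\tau_0',\tau_0,\tau^*}\subset\mathcal{H}^3[-\tau^*,0]$ and the operator $\mathcal{T}$ acting on $L_2[-\tau^*,0]$ be as defined in the context. Then: 1. For any $\phi\in S_{\tau_0',\tau_0,\tau^*}$, $\mathcal{T}\phi'''=\phi$. 2. For any $\nu\in L_2[-\tau^*,0]$, $\mathcal{T}\nu\in S_{\tau_0',\tau_0,\tau^*}$. 3. For any $\nu\in L_2[-\tau^*,0]$, $(\mathcal{T}\nu)'''=\nu$.
   Context: $L_2[-\tau^*,0]$ is the space of real-valued square-integrable functions on $[-\tau^*,0]$, and $\mathcal{H}^3[-\tau^*,0]$ is the Sobolev space of real-valued functions on $[-\tau^*,0]$ with third weak derivative in $L_2$; elements of $\mathcal{H}^3[-\tau^*,0]$ are identified with their $\mathcal{C}^2$ representatives, and third derivatives are weak derivatives (elements of $L_2$). Here $\tau_0'$ is simply a real parameter (not a derivative of $\tau_0$). The set of (not necessarily monotone) seed functions is $$S_{\tau_0',\tau_0,\tau^*}:=\left\{\phi\in\mathcal{H}^3[-\tau^*,0]\ :\ \phi(0)=0,\ \ \phi(-\tau^* )=-\tau_0,\ \ \phi'(0)=\frac{\phi'(-\tau^* )}{1-\tau_0'}\right\}.$$ The operator $\mathcal{T}$ is defined, for $\nu\in L_2[-\tau^*,0]$ and $\lambda\in[-\tau^*,0]$, by $$(\mathcal{T}\nu)(\lambda)=-\tau_0+\tau_0\beta(\lambda)+\int_{-\tau^*}^{0}K(\lambda,\eta)\nu(\eta)\,d\eta+\int_{-\tau^*}^{\lambda}\frac{(\lambda-\eta)^2}{2}\nu(\eta)\,d\eta,$$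 where $$\beta(\lambda)=\frac{2(1-\tau_0')}{(2-\tau_0')\tau^*}(\lambda+\tau^* )+\frac{\tau_0'}{(2-\tau_0')(\tau^* )^2}(\lambda+\tau^* )^2$$ and $$K(\lambda,\eta)=\frac{1-\tau_0'}{2-\tau_0'}\left(-\eta-\frac{\eta^2}{\tau^*}\right)(\lambda+\tau^* )-\frac{1}{2-\tau_0'}\left(\frac{\tau_0'\eta^2}{2(\tau^* )^2}-\frac{1-\tau_0'}{\tau^*}\eta\right)(\lambda+\tau^* )^2.$$ *)

theory Defs
  imports "HOL-Analysis.Analysis"
begin

text \<open>
  Functions on the interval [a, b] are rendered as total functions on the reals; no notion
  below depends on the values outside [a, b]. Elements of L2 are rendered by representatives,
  without passing to almost-everywhere classes.
\<close>

definition L2_on :: "real \<Rightarrow> real \<Rightarrow> (real \<Rightarrow> real) set" where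
  "L2_on a b = {f. set_borel_measurable lebesgue {a..b} f \<and>
                   set_integrable lebesgue {a..b} (\<lambda>x. (f x)\<^sup>2)}"

definition test_functions :: "real \<Rightarrow> real \<Rightarrow> (real \<Rightarrow> real) set" where
  "test_functions a b = {\<psi>. (\<forall>n x. (deriv ^^ n) \<psi> field_differentiable (at x)) \<and>
                             compact (closure {x. \<psi> x \<noteq> 0}) \<and>
                             closure {x. \<psi> x \<noteq> 0} \<subseteq> {a<..<b}}"

text \<open>
  The function g represents the k-th weak derivative of f on (a, b), and both are in L2.
  This is a relation because g is determined only up to null sets.
\<close>

definition has_weak_deriv ::
    "nat \<Rightarrow> real \<Rightarrow> real \<Rightarrow> (real \<Rightarrow> real) \<Rightarrow> (real \<Rightarrow> real) \<Rightarrow> bool" where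
  "has_weak_deriv k a b f g \<longleftrightarrow>
     f \<in> L2_on a b \<and> g \<in> L2_on a b \<and>
     (\<forall>\<psi>\<in>test_functions a b.
        (LINT x:{a..b}|lebesgue. f x * (deriv ^^ k) \<psi> x) =
        (-1) ^ k * (LINT x:{a..b}|lebesgue. g x * \<psi> x))"

definition sobolev :: "nat \<Rightarrow> real \<Rightarrow> real \<Rightarrow> (real \<Rightarrow> real) set" where
  "sobolev k a b = {f \<in> L2_on a b. \<forall>j\<le>k. \<exists>g. has_weak_deriv j a b f g}"

text \<open>Classical derivative on [a, b], one-sided at the end points.\<close>

definition deriv_on :: "real \<Rightarrow> real \<Rightarrow> (real \<Rightarrow> real) \<Rightarrow> real \<Rightarrow> real" where
  "deriv_on a b f x = vector_derivative f (at x within {a..b})"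

definition C2_on :: "real \<Rightarrow> real \<Rightarrow> (real \<Rightarrow> real) set" where
  "C2_on a b = {f. f differentiable_on {a..b} \<and>
                   deriv_on a b f differentiable_on {a..b} \<and>
                   continuous_on {a..b} (deriv_on a b (deriv_on a b f))}"

text \<open>
  In the definitions below, \<open>d\<close> is the real parameter written as tau-zero-prime in the literature
  (not a derivative), \<open>\<tau>0\<close> is tau-zero and \<open>\<tau>s\<close> is tau-star. The intersection with \<open>C2_on\<close>
  selects the twice continuously differentiable representative of each Sobolev class.
\<close>

definition seed_functions :: "real \<Rightarrow> real \<Rightarrow> real \<Rightarrow> (real \<Rightarrow> real) set" where
  "seed_functions d \<tau>0 \<tau>s =
     {\<phi> \<in> sobolev 3 (- \<tau>s) 0 \<inter> C2_on (- \<tau>s) 0.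
        \<phi> 0 = 0 \<and> \<phi> (- \<tau>s) = - \<tau>0 \<and>
        deriv_on (- \<tau>s) 0 \<phi> 0 = deriv_on (- \<tau>s) 0 \<phi> (- \<tau>s) / (1 - d)}"

definition seed_beta :: "real \<Rightarrow> real \<Rightarrow> real \<Rightarrow> real" where
  "seed_beta d \<tau>s x =
     2 * (1 - d) / ((2 - d) * \<tau>s) * (x + \<tau>s) + d / ((2 - d) * \<tau>s\<^sup>2) * (x + \<tau>s)\<^sup>2"

definition seed_kernel :: "real \<Rightarrow> real \<Rightarrow> real \<Rightarrow> real \<Rightarrow> real" where
  "seed_kernel d \<tau>s x \<eta> =
     (1 - d) / (2 - d) * (- \<eta> - \<eta>\<^sup>2 / \<tau>s) * (x + \<tau>s)
     - 1 / (2 - d) * (d * \<eta>\<^sup>2 / (2 * \<tau>s\<^sup>2) - (1 - d) / \<tau>s * \<eta>) * (x + \<tau>s)\<^sup>2"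

definition seed_operator ::
    "real \<Rightarrow> real \<Rightarrow> real \<Rightarrow> (real \<Rightarrow> real) \<Rightarrow> real \<Rightarrow> real" where
  "seed_operator d \<tau>0 \<tau>s \<nu> x =
     - \<tau>0 + \<tau>0 * seed_beta d \<tau>s x
     + (LINT \<eta>:{- \<tau>s..0}|lebesgue. seed_kernel d \<tau>s x \<eta> * \<nu> \<eta>)
     + (LINT \<eta>:{- \<tau>s..x}|lebesgue. (x - \<eta>)\<^sup>2 / 2 * \<nu> \<eta>)"

end

(* Integration by parts against the indefinite integral V of an L2 function nu shows that
   T nu is a quadratic polynomial plus the threefold iterated integral of nu, so T nu is C^2 with
   second derivative c + V, whose weak derivative is nu; the coefficients of beta and K make the
   polynomial match the three boundary conditions. Conversely, if phi is a seed function with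
   third weak derivative g, then phi - T g is C^2 and its second derivative is constant by the
   lemma of du Bois-Reymond, so it is a quadratic polynomial, and the homogeneous boundary
   conditions force it to vanish when d < 1 (this uses 2 - d > 0).
   Du Bois-Reymond needs smooth compactly supported functions, built from exp (- 1/x). *)
theory Submission
  imports Defs
begin

section \<open>Integration by parts\<close>

lemma L2_on_absolutely_integrable:
  assumes "f \<in> L2_on a b"
  shows "f absolutely_integrable_on {a..b}"
proof -
  have m: "set_borel_measurable lebesgue {a..b} f"
    and i: "set_integrable lebesgue {a..b} (\<lambda>x. (f x)\<^sup>2)"
    using assms by (auto simp: L2_on_def)
  \<comment> \<open>Constants are integrable on a bounded interval, so
    \<open>1 + (f x)\<^sup>2\<close> is an integrable majorant of \<open>\<bar>f x\<bar>\<close>;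
    the bound itself comes from expanding a square.\<close>
  have "set_integrable lebesgue {a..b} (\<lambda>x. 1 + (f x)\<^sup>2)"
    by (intro set_integral_add i absolutely_integrable_continuous_real continuous_intros)
  moreover note m
  moreover have "norm (f x) \<le> norm (1 + (f x)\<^sup>2)" for x
  proof -
    have "0 \<le> (\<bar>f x\<bar> - 1)\<^sup>2" "0 \<le> \<bar>f x\<bar>" by simp_all
    then have "\<bar>f x\<bar> \<le> 1 + (f x)\<^sup>2"
      unfolding power2_diff by simp
    then show ?thesis by simp
  qed
  ultimately show ?thesis
    by (auto intro: set_integrable_bound)
qed

lemma continuous_on_L2_on:
  assumes "continuous_on {a..b} f"
  shows "f \<in> L2_on a b"
proof -
  have "f absolutely_integrable_on {a..b}"
    using assms by (rule absolutely_integrable_continuous_real)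
  then have "set_borel_measurable lebesgue {a..b} f"
    unfolding set_integrable_def set_borel_measurable_def by auto
  moreover have "(\<lambda>x. (f x)\<^sup>2) absolutely_integrable_on {a..b}"
    by (intro absolutely_integrable_continuous_real continuous_intros assms)
  ultimately show ?thesis by (simp add: L2_on_def)
qed

lemma absolutely_integrable_mult_continuous:
  fixes f p :: "real \<Rightarrow> real"
  assumes "f absolutely_integrable_on {a..b}" "continuous_on {a..b} p"
  shows "(\<lambda>x. f x * p x) absolutely_integrable_on {a..b}"
proof -
  have "(\<lambda>x. p x * f x) absolutely_integrable_on {a..b}"
    using assms
    by (intro absolutely_integrable_bounded_measurable_product_real)
      (auto intro!: continuous_imp_measurable_on_sets_lebesgue compact_imp_bounded
          compact_continuous_image)
  then show ?thesis by (simp add: mult.commute)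
qed

text \<open>The definitions use Lebesgue integrals over sets, whereas the fundamental theorem of
  calculus and the indefinite integrals below concern the gauge integral. This converts the former
  into the latter.\<close>

lemma LINT_eq_integral:
  fixes f p :: "real \<Rightarrow> real"
  assumes "f absolutely_integrable_on {a..b}" "continuous_on {a..b} p"
  shows "(LINT x:{a..b}|lebesgue. f x * p x) = integral {a..b} (\<lambda>x. f x * p x)"
  using absolutely_integrable_mult_continuous[OF assms]
  by (rule set_lebesgue_integral_eq_integral)

text \<open>Points of \<open>{u..v}\<close> are at most \<open>v - u\<close> apart, so the Lipschitz
  bound takes the factor \<open>P s - P t\<close> out of the integral. This is the error estimate
  for differentiating the auxiliary function \<open>D\<close> in the integration by parts
  below.\<close>

lemma indefinite_integral_product_remainder:
  fixes g P :: "real \<Rightarrow> real"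
  assumes g: "g absolutely_integrable_on {a..b}" and P: "continuous_on {a..b} P"
    and lip: "\<And>u v. u \<in> {a..b} \<Longrightarrow> v \<in> {a..b} \<Longrightarrow> \<bar>P u - P v\<bar> \<le> L * \<bar>u - v\<bar>"
    and L: "0 \<le> L" and uv: "a \<le> u" "u \<le> v" "v \<le> b"
    and s: "s \<in> {u..v}"
  shows "\<bar>integral {u..v} (\<lambda>t. g t * (P s - P t))\<bar> \<le> L * (v - u) * integral {u..v} (\<lambda>t. \<bar>g t\<bar>)"
proof -
  have sub: "{u..v} \<subseteq> {a..b}" using uv by auto
  have g': "g absolutely_integrable_on {u..v}"
    using g _ sub by (rule set_integrable_subset) auto
  have P': "continuous_on {u..v} P" using P sub continuous_on_subset by blast
  have "norm (integral {u..v} (\<lambda>t. g t * (P s - P t)))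
      \<le> integral {u..v} (\<lambda>t. L * (v - u) * \<bar>g t\<bar>)"
  proof (rule integral_norm_bound_integral)
    show "(\<lambda>t. g t * (P s - P t)) integrable_on {u..v}"
      by (intro set_lebesgue_integral_eq_integral(1) absolutely_integrable_mult_continuous
          continuous_intros g' P')
    show "(\<lambda>t. L * (v - u) * \<bar>g t\<bar>) integrable_on {u..v}"
      using g' absolutely_integrable_on_def by (intro integrable_on_mult_right) (auto simp: real_norm_def[symmetric] simp del: real_norm_def)
    fix t assume t: "t \<in> {u..v}"
    have "\<bar>P s - P t\<bar> \<le> L * \<bar>s - t\<bar>" using s t sub by (intro lip) auto
    also have "\<dots> \<le> L * (v - u)" using s t L by (intro mult_left_mono) auto
    finally have "\<bar>P s - P t\<bar> * \<bar>g t\<bar> \<le> L * (v - u) * \<bar>g t\<bar>"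
      by (rule mult_right_mono) simp
    then show "norm (g t * (P s - P t)) \<le> L * (v - u) * \<bar>g t\<bar>"
      by (simp add: abs_mult mult.commute)
  qed
  then show ?thesis by simp
qed

lemma integration_by_parts_indefinite_integral:
  fixes g P p :: "real \<Rightarrow> real"
  assumes ab: "a \<le> b" and g: "g absolutely_integrable_on {a..b}"
    and dP: "\<And>x. x \<in> {a..b} \<Longrightarrow> (P has_vector_derivative p x) (at x within {a..b})"
    and p: "continuous_on {a..b} p"
  shows "((\<lambda>x. integral {a..x} g * p x) has_integral
           integral {a..b} (\<lambda>t. g t * (P b - P t))) {a..b}"
proof -
  have P: "continuous_on {a..b} P"
    using dP has_vector_derivative_continuous continuous_on_eq_continuous_within by blast
  have "bounded (p ` {a..b})"
    using p by (intro compact_imp_bounded compact_continuous_image) auto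
  then obtain L0 where "\<forall>y\<in>p ` {a..b}. norm y \<le> L0"
    unfolding bounded_iff by blast
  then have L0: "\<bar>p x\<bar> \<le> L0" if "x \<in> {a..b}" for x
    using that by auto
  define L where "L = max 0 L0"
  have L: "0 \<le> L" and Lp: "\<And>x. x \<in> {a..b} \<Longrightarrow> \<bar>p x\<bar> \<le> L"
    using L0 by (auto simp: L_def le_max_iff_disj)
  have lip: "\<bar>P u - P v\<bar> \<le> L * \<bar>u - v\<bar>" if "u \<in> {a..b}" "v \<in> {a..b}" for u v
  proof -
    have "norm (P u - P v) \<le> L * norm (u - v)"
    proof (rule field_differentiable_bound[of "{a..b}" P p])
      show "(P has_field_derivative p z) (at z within {a..b})" if "z \<in> {a..b}" for z
        using dP[OF that] by (simp add: has_real_derivative_iff_has_vector_derivative)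
    qed (use that Lp in auto)
    then show ?thesis by simp
  qed
  have gi: "g integrable_on {a..b}" and gPi: "(\<lambda>t. g t * P t) integrable_on {a..b}"
    and gai: "(\<lambda>t. \<bar>g t\<bar>) integrable_on {a..b}"
    using g absolutely_integrable_mult_continuous[OF g P] by (auto simp: absolutely_integrable_on_def)
  define V where "V = (\<lambda>x. integral {a..x} g)"
  define W where "W = (\<lambda>x. integral {a..x} (\<lambda>t. \<bar>g t\<bar>))"
  \<comment> \<open>In other words, \<open>D x\<close> is the integral of
    \<open>g t * (P x - P t)\<close> over \<open>{a..x}\<close>.\<close>
  define D where "D = (\<lambda>x. V x * P x - integral {a..x} (\<lambda>t. g t * P t))"
  have W: "continuous_on {a..b} W"
    unfolding W_def by (rule indefinite_integral_continuous_1[OF gai])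
  \<comment> \<open>Up to sign, the left side is the integral of \<open>g t * (P y - P t)\<close>
    between \<open>x\<close> and \<open>y\<close>. The bound is \<open>\<bar>y - x\<bar>\<close>
    times an increment of the continuous function \<open>W\<close>, hence o(y - x), although
    \<open>g\<close> may be unbounded.\<close>
  have rem: "\<bar>D y - D x - V x * (P y - P x)\<bar> \<le> L * \<bar>y - x\<bar> * \<bar>W y - W x\<bar>"
    if x: "x \<in> {a..b}" and y: "y \<in> {a..b}" for x y
  proof -
    \<comment> \<open>Sorting the two points treats both orders at once; \<open>y\<close> is an end
      point of \<open>{u..v}\<close> either way, so it can be the base point \<open>s\<close> of the
      remainder estimate.\<close>
    define u v where "u = min x y" and "v = max x y"
    have uv: "a \<le> u" "u \<le> v" "v \<le> b" using x y by (auto simp: u_def v_def)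
    have split: "integral {a..v} h - integral {a..u} h = integral {u..v} h"
      if "h integrable_on {a..b}" for h :: "real \<Rightarrow> real"
    proof -
      have "h integrable_on {a..v}"
        using that by (rule integrable_on_subinterval) (use uv in auto)
      then show ?thesis using Henstock_Kurzweil_Integration.integral_combine[of a u v h] uv by simp
    qed
    have gi': "g integrable_on {u..v}" "(\<lambda>t. g t * P t) integrable_on {u..v}"
      using gi gPi uv by (auto intro: integrable_on_subinterval)
    have "integral {u..v} (\<lambda>t. g t * (P y - P t))
        = integral {u..v} g * P y - integral {u..v} (\<lambda>t. g t * P t)"
      using gi' by (simp add: right_diff_distrib integral_diff integrable_on_mult_left)
    moreover have "\<bar>integral {u..v} (\<lambda>t. g t * (P y - P t))\<bar>
        \<le> L * (v - u) * integral {u..v} (\<lambda>t. \<bar>g t\<bar>)"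
      using g P lip L uv
      by (rule indefinite_integral_product_remainder) (auto simp: u_def v_def)
    ultimately have *: "\<bar>(V v - V u) * P y - integral {u..v} (\<lambda>t. g t * P t)\<bar>
        \<le> L * (v - u) * (W v - W u)"
      unfolding V_def W_def split[OF gi] split[OF gai] by simp
    have "0 \<le> W v - W u"
      unfolding W_def split[OF gai] by (rule Henstock_Kurzweil_Integration.integral_nonneg) (use gai uv in \<open>auto intro: integrable_on_subinterval\<close>)
    then have W': "(v - u) * (W v - W u) = \<bar>y - x\<bar> * \<bar>W y - W x\<bar>"
      by (auto simp: u_def v_def min_def max_def)
    have "\<bar>D y - D x - V x * (P y - P x)\<bar> = \<bar>(V v - V u) * P y - integral {u..v} (\<lambda>t. g t * P t)\<bar>"
      unfolding D_def split[OF gPi, symmetric]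
      by (auto simp: u_def v_def min_def max_def algebra_simps abs_if)
    with * W' show ?thesis by (simp add: mult.assoc)
  qed
  have dD: "(D has_vector_derivative V x * p x) (at x within {a..b})" if x: "x \<in> {a..b}" for x
  proof -
    have Px: "((\<lambda>y. (P y - P x) / (y - x)) \<longlongrightarrow> p x) (at x within {a..b})"
      using dP[OF x] unfolding has_real_derivative_iff_has_vector_derivative[symmetric]
        has_field_derivative_iff .
    have "((\<lambda>y. L * \<bar>W y - W x\<bar>) \<longlongrightarrow> L * \<bar>W x - W x\<bar>) (at x within {a..b})"
      using W x by (intro tendsto_intros) (auto simp: continuous_on_def)
    then have W0: "((\<lambda>y. L * \<bar>W y - W x\<bar>) \<longlongrightarrow> 0) (at x within {a..b})" by simp
    have "((\<lambda>y. (D y - D x - V x * (P y - P x)) / (y - x)) \<longlongrightarrow> 0) (at x within {a..b})"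
    proof (rule Lim_null_comparison[OF _ W0])
      show "\<forall>\<^sub>F y in at x within {a..b}.
          norm ((D y - D x - V x * (P y - P x)) / (y - x)) \<le> L * \<bar>W y - W x\<bar>"
        unfolding eventually_at_filter
      proof (intro always_eventually allI impI)
        fix y assume y: "y \<noteq> x" "y \<in> {a..b}"
        show "norm ((D y - D x - V x * (P y - P x)) / (y - x)) \<le> L * \<bar>W y - W x\<bar>"
          using rem[OF x y(2)] y(1) by (simp add: divide_le_eq mult_ac)
      qed
    qed
    from tendsto_add[OF this tendsto_mult_left[OF Px, of "V x"]]
    have "((\<lambda>y. (D y - D x) / (y - x)) \<longlongrightarrow> V x * p x) (at x within {a..b})"
      by (simp add: diff_divide_distrib right_diff_distrib)
    then show ?thesis
      unfolding has_real_derivative_iff_has_vector_derivative[symmetric] has_field_derivative_iff .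
  qed
  have "((\<lambda>x. V x * p x) has_integral D b - D a) {a..b}"
    using ab dD by (rule fundamental_theorem_of_calculus)
  moreover have "D b - D a = integral {a..b} (\<lambda>t. g t * (P b - P t))"
    using gi gPi by (simp add: D_def V_def right_diff_distrib integral_diff integrable_on_mult_left)
  ultimately show ?thesis by (simp add: V_def)
qed

section \<open>Classical derivatives on a closed interval\<close>

lemma deriv_on_eq:
  assumes "a < b" "x \<in> {a..b}" "(f has_vector_derivative D) (at x within {a..b})"
  shows "deriv_on a b f x = D"
  \<comment> \<open>By \<open>a < b\<close>, the derivative within the interval is unique even at
    the end points, so the value chosen by \<open>vector_derivative\<close> is
    \<open>D\<close>.\<close>
  unfolding deriv_on_def using vector_derivative_within_cbox[of a b x f D] assms by auto

lemma C2_onI: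
  fixes f f' f'' :: "real \<Rightarrow> real"
  assumes ab: "a < b"
    and f: "\<And>x. x \<in> {a..b} \<Longrightarrow> (f has_vector_derivative f' x) (at x within {a..b})"
    and f': "\<And>x. x \<in> {a..b} \<Longrightarrow> (f' has_vector_derivative f'' x) (at x within {a..b})"
    and c: "continuous_on {a..b} f''"
  shows "f \<in> C2_on a b"
proof -
  have e1: "deriv_on a b f x = f' x" if "x \<in> {a..b}" for x
    using deriv_on_eq[OF ab that f[OF that]] .
  \<comment> \<open>\<open>deriv_on a b f\<close> is known to agree with \<open>f'\<close> only on
    the interval, which suffices for derivatives within it.\<close>
  have d1: "(deriv_on a b f has_vector_derivative f'' x) (at x within {a..b})" if "x \<in> {a..b}" for x
    using f'[OF that] by (rule has_vector_derivative_transform[OF that, rotated]) (simp add: e1)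
  have e2: "deriv_on a b (deriv_on a b f) x = f'' x" if "x \<in> {a..b}" for x
    using deriv_on_eq[OF ab that d1[OF that]] .
  have "continuous_on {a..b} (deriv_on a b (deriv_on a b f))"
    using c by (rule continuous_on_eq) (simp add: e2)
  then show ?thesis
    unfolding C2_on_def differentiable_on_def mem_Collect_eq
    using differentiableI_vector[OF f] differentiableI_vector[OF d1] by blast
qed

lemma C2_onD:
  assumes "f \<in> C2_on a b" "x \<in> {a..b}"
  shows "(f has_vector_derivative deriv_on a b f x) (at x within {a..b})"
    and "(deriv_on a b f has_vector_derivative deriv_on a b (deriv_on a b f) x) (at x within {a..b})"
  using assms unfolding C2_on_def differentiable_on_def deriv_on_def
  by (auto simp: vector_derivative_works)

section \<open>Smooth bump functions and the lemma of du Bois-Reymond\<close>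

text \<open>The standard smooth function that is flat at 0, divided by a power of \<open>x\<close>.
  The power is a parameter because differentiation raises it, so all derivatives are linear
  combinations of members of this one family.\<close>

definition flat_exp :: "nat \<Rightarrow> real \<Rightarrow> real" where
  "flat_exp k x = (if 0 < x then exp (- (1 / x)) / x ^ k else 0)"

text \<open>From the right, the substitution y = 1/h turns the difference quotient into
  \<open>y ^ Suc k / exp y\<close>, which tends to 0 as y grows; from the left the quotient is
  identically 0.\<close>

lemma flat_exp_derivative_0: "(flat_exp k has_real_derivative 0) (at 0)"
proof -
  have "((\<lambda>y::real. y ^ Suc k / exp y) \<longlongrightarrow> 0) at_top"
    by (rule tendsto_power_div_exp_0)
  then have "((\<lambda>h. inverse h ^ Suc k / exp (inverse h)) \<longlongrightarrow> 0) (at_right (0::real))"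
    by (rule filterlim_compose) (rule filterlim_inverse_at_top_right)
  then have "((\<lambda>h. (flat_exp k h - flat_exp k 0) / h) \<longlongrightarrow> 0) (at_right 0)"
    by (rule Lim_transform_eventually)
      (auto simp: flat_exp_def eventually_at_filter exp_minus field_simps intro!: always_eventually)
  moreover have "((\<lambda>h. (flat_exp k h - flat_exp k 0) / h) \<longlongrightarrow> 0) (at_left 0)"
    by (rule Lim_transform_eventually[OF tendsto_const])
      (auto simp: flat_exp_def eventually_at_filter intro!: always_eventually)
  ultimately show ?thesis
    by (simp add: has_field_derivative_iff filterlim_split_at)
qed

text \<open>The derivative is written as a sum with a constant multiple so that it matches the
  closure rules of \<open>smooth_funs\<close>.\<close>

lemma flat_exp_derivative:
  "(flat_exp k has_real_derivative flat_exp (k + 2) x + - real k * flat_exp (k + 1) x) (at x)"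
proof -
  consider "x < 0" | "x = 0" | "x > 0" by linarith
  then show ?thesis
  proof cases
    case 1
    have "(flat_exp k has_real_derivative 0) (at x)"
      by (rule has_field_derivative_transform_within_open[of "\<lambda>_. 0" _ _ "{..<0}"])
        (use 1 in \<open>auto simp: flat_exp_def\<close>)
    then show ?thesis using 1 by (simp add: flat_exp_def)
  next
    case 2
    then show ?thesis using flat_exp_derivative_0 by (simp add: flat_exp_def)
  next
    case 3
    have "((\<lambda>x. exp (- (1 / x))) has_real_derivative exp (- (1 / x)) / x\<^sup>2) (at x)"
      using 3 by (auto intro!: derivative_eq_intros simp: power2_eq_square)
    from DERIV_divide[OF this DERIV_pow[of k]]
    have "((\<lambda>x. exp (- (1 / x)) / x ^ k) has_real_derivative
        (exp (- (1 / x)) / x\<^sup>2 * x ^ k - exp (- (1 / x)) * (real k * x ^ (k - Suc 0))) / (x ^ k * x ^ k))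
        (at x)"
      using 3 by simp
    \<comment> \<open>The split on \<open>k\<close> deals with the truncated exponent
      \<open>k - Suc 0\<close>; for \<open>k = 0\<close> the factor \<open>real k\<close> removes
      that term.\<close>
    moreover have "(exp (- (1 / x)) / x\<^sup>2 * x ^ k - exp (- (1 / x)) * (real k * x ^ (k - Suc 0))) / (x ^ k * x ^ k)
        = flat_exp (k + 2) x + - real k * flat_exp (k + 1) x"
      using 3 by (cases k) (simp_all add: flat_exp_def field_simps power2_eq_square)
    ultimately have "((\<lambda>x. exp (- (1 / x)) / x ^ k) has_real_derivative
        flat_exp (k + 2) x + - real k * flat_exp (k + 1) x) (at x)"
      by simp
    then show ?thesis
      by (rule has_field_derivative_transform_within_open[of _ _ _ "{0<..}"])
        (use 3 in \<open>auto simp: flat_exp_def\<close>)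
  qed
qed

text \<open>A class of functions generated so as to be closed under differentiation. Its members are
  therefore infinitely differentiable, and no formulas for higher derivatives of products or
  compositions are needed. The rule \<open>antiderivative\<close> brings in primitives of bump
  functions.\<close>

inductive_set smooth_funs :: "(real \<Rightarrow> real) set" where
  flat: "flat_exp k \<in> smooth_funs"
| const: "(\<lambda>_. c) \<in> smooth_funs"
| add: "f \<in> smooth_funs \<Longrightarrow> g \<in> smooth_funs \<Longrightarrow> (\<lambda>x. f x + g x) \<in> smooth_funs"
| mult: "f \<in> smooth_funs \<Longrightarrow> g \<in> smooth_funs \<Longrightarrow> (\<lambda>x. f x * g x) \<in> smooth_funs"
| affine: "f \<in> smooth_funs \<Longrightarrow> (\<lambda>x. f (c * x + e)) \<in> smooth_funs"
| antiderivative: "f \<in> smooth_funs \<Longrightarrow> (\<And>x. (F has_real_derivative f x) (at x)) \<Longrightarrow> F \<in> smooth_funs"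

text \<open>Each introduction rule has a matching differentiation rule whose result is built from
  members of the class again; for \<open>antiderivative\<close> the derivative is the given
  function.\<close>

lemma smooth_funs_has_derivative:
  assumes "f \<in> smooth_funs"
  shows "\<exists>f'\<in>smooth_funs. \<forall>x. (f has_real_derivative f' x) (at x)"
  using assms
proof induction
  case (flat k)
  have "(\<lambda>x. flat_exp (k + 2) x + - real k * flat_exp (k + 1) x) \<in> smooth_funs"
    by (intro smooth_funs.intros)
  with flat_exp_derivative show ?case
    by (intro bexI[of _ "\<lambda>x. flat_exp (k + 2) x + - real k * flat_exp (k + 1) x"]) auto
next
  case (const c)
  show ?case by (rule bexI[of _ "\<lambda>_. 0"]) (auto intro: smooth_funs.intros)
next
  case (add f g)
  then obtain f' g' where "f' \<in> smooth_funs" "g' \<in> smooth_funs"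
    "\<And>x. (f has_real_derivative f' x) (at x)" "\<And>x. (g has_real_derivative g' x) (at x)"
    by blast
  then show ?case
    by (intro bexI[of _ "\<lambda>x. f' x + g' x"]) (auto intro: smooth_funs.intros DERIV_add)
next
  case (mult f g)
  then obtain f' g' where "f' \<in> smooth_funs" "g' \<in> smooth_funs"
    "\<And>x. (f has_real_derivative f' x) (at x)" "\<And>x. (g has_real_derivative g' x) (at x)"
    by blast
  with mult.hyps show ?case
    by (intro bexI[of _ "\<lambda>x. f' x * g x + g' x * f x"]) (auto intro: smooth_funs.intros DERIV_mult)
next
  case (affine f c e)
  then obtain f' where f': "f' \<in> smooth_funs" "\<And>x. (f has_real_derivative f' x) (at x)"
    by blast
  have "((\<lambda>x. f (c * x + e)) has_real_derivative f' (c * x + e) * c) (at x)" for x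
    by (rule DERIV_chain2[OF f'(2)]) (auto intro!: derivative_eq_intros)
  then show ?case
    using f'(1) by (intro bexI[of _ "\<lambda>x. f' (c * x + e) * c"]) (auto intro: smooth_funs.intros)
next
  case (antiderivative f F)
  then show ?case by blast
qed

lemma smooth_funs_deriv:
  assumes "f \<in> smooth_funs"
  shows "deriv f \<in> smooth_funs" "(f has_real_derivative deriv f x) (at x)"
proof -
  obtain f' where f': "f' \<in> smooth_funs" "\<And>x. (f has_real_derivative f' x) (at x)"
    using smooth_funs_has_derivative[OF assms] by blast
  then have "deriv f = f'" by (intro ext DERIV_imp_deriv)
  with f' show "deriv f \<in> smooth_funs" "(f has_real_derivative deriv f x) (at x)" by auto
qed

lemma smooth_funs_funpow_deriv: "f \<in> smooth_funs \<Longrightarrow> (deriv ^^ n) f \<in> smooth_funs"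
  by (induction n) (auto intro: smooth_funs_deriv)

lemma smooth_funs_continuous_on: "f \<in> smooth_funs \<Longrightarrow> continuous_on S f"
  by (meson DERIV_isCont continuous_at_imp_continuous_on smooth_funs_deriv(2))

text \<open>A product of two mirrored flat exponentials is positive exactly where both arguments
  are, that is on (-r, r). The primitive \<open>F\<close> is constant on either side of that
  interval, so the difference of two translates of \<open>F\<close> has compact support.\<close>

lemma smooth_bump:
  fixes r :: real
  assumes "0 < r"
  obtains \<rho> F where "\<rho> \<in> smooth_funs" "F \<in> smooth_funs"
    "\<And>x. (F has_real_derivative \<rho> x) (at x)"
    "\<And>x. 0 \<le> \<rho> x" "\<And>x. 0 < \<rho> x \<longleftrightarrow> \<bar>x\<bar> < r"
    "\<And>x. x \<le> - r \<Longrightarrow> F x = F (- r)" "\<And>x. r \<le> x \<Longrightarrow> F x = F r"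
proof -
  define \<rho> where "\<rho> = (\<lambda>x. flat_exp 0 (1 * x + r) * flat_exp 0 (- 1 * x + r))"
  have \<rho>: "\<rho> \<in> smooth_funs"
    unfolding \<rho>_def by (intro smooth_funs.intros)
  have nonneg: "0 \<le> \<rho> x" and pos: "0 < \<rho> x \<longleftrightarrow> \<bar>x\<bar> < r" for x
    by (auto simp: \<rho>_def flat_exp_def)
  \<comment> \<open>Taking the whole line as the interval gives a primitive defined
    everywhere.\<close>
  have "\<exists>F. \<forall>x::real. - \<infinity> < ereal x \<longrightarrow> ereal x < \<infinity> \<longrightarrow> (F has_vector_derivative \<rho> x) (at x)"
    using DERIV_isCont smooth_funs_deriv(2)[OF \<rho>] by (intro einterval_antiderivative) auto
  then obtain F where F: "\<And>x. (F has_real_derivative \<rho> x) (at x)"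
    by (auto simp: has_real_derivative_iff_has_vector_derivative)
  have zero: "\<rho> x = 0" if "r \<le> \<bar>x\<bar>" for x
    using nonneg[of x] pos[of x] that by linarith
  have Fconst: "F x = F y" if "\<And>z. z \<in> {x..y} \<Longrightarrow> \<rho> z = 0" "x \<le> y" for x y
  proof -
    have "\<exists>c. \<forall>z\<in>{x..y}. F z = c"
    proof (rule has_field_derivative_zero_constant)
      show "(F has_field_derivative 0) (at z within {x..y})" if "z \<in> {x..y}" for z
        using has_field_derivative_at_within[OF F, of z "{x..y}"] \<open>\<And>z. z \<in> {x..y} \<Longrightarrow> \<rho> z = 0\<close>[OF that] by simp
    qed simp
    then show ?thesis using that(2) by auto
  qed
  show ?thesis
  proof (rule that[of \<rho> F])
    show "F x = F (- r)" if "x \<le> - r" for x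
      using that assms by (intro Fconst zero) auto
    show "F x = F r" if "r \<le> x" for x
      using that assms by (intro Fconst[symmetric] zero) auto
    show "F \<in> smooth_funs" using \<rho> F by (rule smooth_funs.antiderivative)
  qed (fact \<rho> F nonneg pos)+
qed

lemma smooth_funs_test_functions:
  assumes "f \<in> smooth_funs" and "a < u" "v < b" and "\<And>x. x \<notin> {u..v} \<Longrightarrow> f x = 0"
  shows "f \<in> test_functions a b"
proof -
  have "closure {x. f x \<noteq> 0} \<subseteq> {u..v}"
    using assms(4) by (intro closure_minimal) (blast, simp)
  moreover from this have "compact (closure {x. f x \<noteq> 0})"
    by (meson bounded_closed_interval bounded_subset closed_closure compact_eq_bounded_closed)
  moreover have "(deriv ^^ n) f field_differentiable (at x)" for n x
    using smooth_funs_deriv(2)[OF smooth_funs_funpow_deriv[OF assms(1)]]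
    unfolding field_differentiable_def by blast
  ultimately show ?thesis
    using assms(2,3) unfolding test_functions_def by force
qed

text \<open>If \<open>w\<close> were larger at one interior point than at another, a test function
  whose derivative is a bump at the first point minus the same bump at the second would have a
  positive integral against \<open>w\<close>. Hence \<open>w\<close> is constant in the interior,
  and by continuity on the closed interval.\<close>

lemma du_Bois_Reymond:
  fixes w :: "real \<Rightarrow> real"
  assumes ab: "a < b" and w: "continuous_on {a..b} w"
    and orth: "\<And>\<psi>. \<psi> \<in> test_functions a b \<Longrightarrow> integral {a..b} (\<lambda>x. w x * deriv \<psi> x) = 0"
  shows "\<exists>c. \<forall>x\<in>{a..b}. w x = c"
proof -
  have le: "w x1 \<le> w x2" if x: "x1 \<in> {a<..<b}" "x2 \<in> {a<..<b}" for x1 x2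
  proof (rule ccontr)
    assume "\<not> w x1 \<le> w x2"
    \<comment> \<open>The level \<open>m\<close> separates the two values: by continuity
      \<open>w\<close> stays above it near \<open>x1\<close> and below it near
      \<open>x2\<close>.\<close>
    define m where "m = (w x1 + w x2) / 2"
    have m: "w x2 < m" "m < w x1" using \<open>\<not> w x1 \<le> w x2\<close> by (auto simp: m_def)
    have cont: "isCont w x" if "x \<in> {a<..<b}" for x
      using w that by (intro continuous_on_interior) auto
    have "\<forall>\<^sub>F x in nhds x1. m < w x" "\<forall>\<^sub>F x in nhds x2. w x < m"
      using cont[OF x(1)] cont[OF x(2)] m order_tendstoD
      by (metis continuous_at tendsto_at_iff_tendsto_nhds)+
    moreover have "\<forall>\<^sub>F x in nhds x1. x \<in> {a<..<b}" "\<forall>\<^sub>F x in nhds x2. x \<in> {a<..<b}"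
      using x by (auto intro!: eventually_nhds_in_open simp del: greaterThanLessThan_iff)
    ultimately have "\<forall>\<^sub>F x in nhds x1. m < w x \<and> x \<in> {a<..<b}" "\<forall>\<^sub>F x in nhds x2. w x < m \<and> x \<in> {a<..<b}"
      by (auto intro: eventually_conj)
    then obtain r1 r2 where r: "0 < r1" "0 < r2"
        "\<And>x. dist x x1 < r1 \<Longrightarrow> m < w x \<and> x \<in> {a<..<b}"
        "\<And>x. dist x x2 < r2 \<Longrightarrow> w x < m \<and> x \<in> {a<..<b}"
      unfolding eventually_nhds_metric by blast
    \<comment> \<open>Halving makes \<open>r\<close> strictly smaller than both radii, so the closed
      intervals of radius \<open>r\<close> still lie in the two neighbourhoods.\<close>
    define r where "r = min r1 r2 / 2"
    have r0: "0 < r" and rr: "r < r1" "r < r2" using r by (auto simp: r_def)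
    have w1: "m < w x" "x \<in> {a<..<b}" if "\<bar>x - x1\<bar> \<le> r" for x
      using r(3)[of x] that rr by (auto simp: dist_real_def)
    have w2: "w x < m" "x \<in> {a<..<b}" if "\<bar>x - x2\<bar> \<le> r" for x
      using r(4)[of x] that rr by (auto simp: dist_real_def)
    obtain \<rho> F where \<rho>F: "\<rho> \<in> smooth_funs" "F \<in> smooth_funs"
      and F': "\<And>x. (F has_real_derivative \<rho> x) (at x)"
      and \<rho>0: "\<And>x. 0 \<le> \<rho> x" and \<rho>pos: "\<And>x. 0 < \<rho> x \<longleftrightarrow> \<bar>x\<bar> < r"
      and Fc: "\<And>x. x \<le> - r \<Longrightarrow> F x = F (- r)" "\<And>x. r \<le> x \<Longrightarrow> F x = F r"
      using smooth_bump[OF r0] by metis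
    \<comment> \<open>To the left of both bumps the two terms are equal to \<open>F (- r)\<close>,
      to the right to \<open>F r\<close>, so they cancel. The factors \<open>1\<close> and
      \<open>- 1\<close> only fit the expressions to the rules of
      \<open>smooth_funs\<close>.\<close>
    define \<psi> where "\<psi> = (\<lambda>x. F (1 * x + - x1) + - 1 * F (1 * x + - x2))"
    define q where "q = (\<lambda>x. \<rho> (1 * x + - x1) + - 1 * \<rho> (1 * x + - x2))"
    have \<psi>: "\<psi> \<in> smooth_funs" and q: "q \<in> smooth_funs"
      unfolding \<psi>_def q_def by (intro smooth_funs.add smooth_funs.mult smooth_funs.const smooth_funs.affine[of F]
          smooth_funs.affine[of \<rho>] \<rho>F)+
    have d\<psi>: "(\<psi> has_real_derivative q x) (at x)" for x
    proof -
      have "((\<lambda>x. F (1 * x + - e)) has_real_derivative \<rho> (1 * x + - e) * 1) (at x)" for e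
        by (rule DERIV_chain2[OF F']) (auto intro!: derivative_eq_intros)
      from DERIV_add[OF this[of x1] DERIV_cmult[OF this[of x2], of "- 1"]]
      show ?thesis unfolding \<psi>_def q_def by simp
    qed
    then have deriv: "deriv \<psi> = q" by (intro ext DERIV_imp_deriv)
    have out: "\<psi> x = 0" if "x \<notin> {min x1 x2 - r..max x1 x2 + r}" for x
    proof -
      have "x < min x1 x2 - r \<or> max x1 x2 + r < x" using that by auto
      then have "(x - x1 \<le> - r \<and> x - x2 \<le> - r) \<or> (r \<le> x - x1 \<and> r \<le> x - x2)" by auto
      then show ?thesis
        by (elim disjE) (use Fc[of "x - x1"] Fc[of "x - x2"] in \<open>auto simp: \<psi>_def\<close>)
    qed
    have lo: "a < min x1 x2 - r" and hi: "max x1 x2 + r < b"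
      using w1(2)[of "x1 - r"] w2(2)[of "x2 - r"] w1(2)[of "x1 + r"] w2(2)[of "x2 + r"] r0
      by auto
    have test: "\<psi> \<in> test_functions a b"
      using \<psi> lo hi out by (rule smooth_funs_test_functions)
    \<comment> \<open>The two bumps have equal mass, so \<open>q\<close> has integral 0 and
      \<open>w\<close> may be replaced by \<open>w x - m\<close> without changing the integral
      against \<open>q\<close>.\<close>
    have "(q has_integral \<psi> b - \<psi> a) {a..b}"
      using ab d\<psi> by (intro fundamental_theorem_of_calculus)
        (auto simp: has_real_derivative_iff_has_vector_derivative[symmetric]
          intro: has_field_derivative_at_within)
    then have q0: "(q has_integral 0) {a..b}"
      using out[of a] out[of b] lo hi by simp
    have "(\<lambda>x. w x * q x) integrable_on {a..b}"
      by (intro integrable_continuous_real continuous_intros w smooth_funs_continuous_on q)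
    then have "((\<lambda>x. w x * q x) has_integral 0) {a..b}"
      using orth[OF test] unfolding deriv by (metis integrable_integral)
    from has_integral_diff[OF this has_integral_mult_right[OF q0, of m]]
    have "((\<lambda>x. (w x - m) * q x) has_integral 0) {a..b}"
      by (simp add: algebra_simps)
    then have int0: "integral {a..b} (\<lambda>x. (w x - m) * q x) = 0" by (rule integral_unique)
    \<comment> \<open>Where the first bump lives \<open>w\<close> exceeds \<open>m\<close>, and
      where the subtracted one lives \<open>w\<close> is below \<open>m\<close>. A continuous
      nonnegative function with integral 0 vanishes everywhere, in particular at
      \<open>x1\<close>.\<close>
    have "(w x - m) * q x \<ge> 0" for x
    proof -
      have "0 \<le> (w x - m) * \<rho> (x - x1)"
        using w1(1)[of x] \<rho>0[of "x - x1"] \<rho>pos[of "x - x1"]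
        by (cases "\<bar>x - x1\<bar> < r") auto
      moreover have "0 \<le> (m - w x) * \<rho> (x - x2)"
        using w2(1)[of x] \<rho>0[of "x - x2"] \<rho>pos[of "x - x2"]
        by (cases "\<bar>x - x2\<bar> < r") auto
      ultimately show ?thesis by (simp add: q_def algebra_simps)
    qed
    moreover have "continuous_on {a..b} (\<lambda>x. (w x - m) * q x)"
      by (intro continuous_intros w smooth_funs_continuous_on q)
    ultimately have "(w x1 - m) * q x1 = 0"
      using int0 integral_eq_0_iff[of a b "\<lambda>x. (w x - m) * q x"] ab x by auto
    \<comment> \<open>Since \<open>w x1\<close> exceeds \<open>m\<close>, the point
      \<open>x1\<close> is outside the second bump, which therefore cannot cancel the first one
      there.\<close>
    moreover have "0 < q x1"
    proof -
      have "\<not> \<bar>x1 - x2\<bar> \<le> r" using w2(1)[of x1] m by auto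
      then have "\<rho> (x1 - x2) = 0" using \<rho>pos[of "x1 - x2"] \<rho>0[of "x1 - x2"] by auto
      then show ?thesis using \<rho>pos[of 0] r0 by (simp add: q_def)
    qed
    ultimately show False using m by simp
  qed
  \<comment> \<open>The midpoint is an arbitrary interior reference point; \<open>le\<close> is used
    in both directions against it.\<close>
  define c where "c = w ((a + b) / 2)"
  have "w x = c" if "x \<in> {a..b}" for x
  proof (rule continuous_constant_on_closure[of "{a<..<b}" w c])
    show "continuous_on (closure {a<..<b}) w" using w ab by simp
    show "w y = c" if "y \<in> {a<..<b}" for y
      using le[of y "(a + b) / 2"] le[of "(a + b) / 2" y] that ab by (auto simp: c_def)
  qed (use that ab in simp)
  then show ?thesis by blast
qed

section \<open>Weak derivatives\<close>

lemma test_functions_funpow_derivative: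
  assumes "\<psi> \<in> test_functions a b"
  shows "((deriv ^^ n) \<psi> has_real_derivative (deriv ^^ Suc n) \<psi> x) (at x)"
  using assms by (auto simp: test_functions_def DERIV_deriv_iff_field_differentiable)

lemma test_functions_continuous_on:
  "\<psi> \<in> test_functions a b \<Longrightarrow> continuous_on S ((deriv ^^ n) \<psi>)"
  by (meson DERIV_isCont continuous_at_imp_continuous_on test_functions_funpow_derivative)

lemma test_functions_zero:
  assumes "\<psi> \<in> test_functions a b" "x \<notin> {a<..<b}"
  shows "\<psi> x = 0"
proof -
  have "x \<notin> closure {x. \<psi> x \<noteq> 0}"
    using assms by (auto simp: test_functions_def)
  then show ?thesis
    using closure_subset[of "{x. \<psi> x \<noteq> 0}"] by blast
qed

text \<open>Off the support of \<open>\<psi>\<close>, which is closed, \<open>\<psi>\<close>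
  vanishes on a neighbourhood, so the support of \<open>deriv \<psi>\<close> lies inside that of
  \<open>\<psi>\<close>.\<close>

lemma test_functions_deriv:
  assumes "\<psi> \<in> test_functions a b"
  shows "deriv \<psi> \<in> test_functions a b"
proof -
  let ?C = "closure {x. \<psi> x \<noteq> 0}"
  have C: "compact ?C" "?C \<subseteq> {a<..<b}" using assms by (auto simp: test_functions_def)
  have "deriv \<psi> x = 0" if "x \<notin> ?C" for x
  proof -
    have zero: "\<psi> y = 0" if "y \<in> - ?C" for y
      using that closure_subset[of "{x. \<psi> x \<noteq> 0}"] by blast
    have "(\<psi> has_real_derivative 0) (at x)"
    proof (rule has_field_derivative_transform_within_open)
      show "((\<lambda>_. 0) has_real_derivative 0) (at x)" by simp
      show "open (- ?C)" "x \<in> - ?C" using that by (simp_all add: open_Compl)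
    qed (rule zero[symmetric])
    then show ?thesis by (rule DERIV_imp_deriv)
  qed
  then have sub: "closure {x. deriv \<psi> x \<noteq> 0} \<subseteq> ?C"
    by (intro closure_minimal) (blast, simp)
  then have "compact (closure {x. deriv \<psi> x \<noteq> 0})"
    using compact_Int_closed[OF C(1) closed_closure[of "{x. deriv \<psi> x \<noteq> 0}"]]
    by (simp add: Int_absorb1)
  moreover have "(deriv ^^ n) (deriv \<psi>) field_differentiable (at x)" for n x
    using assms unfolding test_functions_def
    by (auto simp: funpow_swap1[symmetric] dest: spec[of _ "Suc n"])
  ultimately show ?thesis
    using sub C by (auto simp: test_functions_def)
qed

lemma test_functions_funpow_deriv:
  "\<psi> \<in> test_functions a b \<Longrightarrow> (deriv ^^ n) \<psi> \<in> test_functions a b"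
  by (induction n) (auto intro: test_functions_deriv)

section \<open>Weak derivatives compared with classical ones\<close>

lemma has_weak_deriv_integral:
  assumes "has_weak_deriv k a b f g" "\<psi> \<in> test_functions a b"
  shows "integral {a..b} (\<lambda>x. f x * (deriv ^^ k) \<psi> x) = (-1) ^ k * integral {a..b} (\<lambda>x. g x * \<psi> x)"
proof -
  have "f absolutely_integrable_on {a..b}" "g absolutely_integrable_on {a..b}"
    using assms(1) L2_on_absolutely_integrable by (auto simp: has_weak_deriv_def)
  moreover have "continuous_on {a..b} ((deriv ^^ k) \<psi>)" "continuous_on {a..b} \<psi>"
    using test_functions_continuous_on[OF assms(2), of _ k] test_functions_continuous_on[OF assms(2), of _ 0]
    by auto
  ultimately show ?thesis
    using assms by (auto simp: has_weak_deriv_def LINT_eq_integral)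
qed

lemma has_weak_derivI:
  assumes "f \<in> L2_on a b" "g \<in> L2_on a b"
    and "\<And>\<psi>. \<psi> \<in> test_functions a b \<Longrightarrow>
      integral {a..b} (\<lambda>x. f x * (deriv ^^ k) \<psi> x) = (-1) ^ k * integral {a..b} (\<lambda>x. g x * \<psi> x)"
  shows "has_weak_deriv k a b f g"
  unfolding has_weak_deriv_def
proof (intro conjI ballI assms)
  fix \<psi> assume \<psi>: "\<psi> \<in> test_functions a b"
  have "continuous_on {a..b} ((deriv ^^ k) \<psi>)" "continuous_on {a..b} \<psi>"
    using test_functions_continuous_on[OF \<psi>, of _ k] test_functions_continuous_on[OF \<psi>, of _ 0]
    by auto
  then show "(LINT x:{a..b}|lebesgue. f x * (deriv ^^ k) \<psi> x) =
      (-1) ^ k * (LINT x:{a..b}|lebesgue. g x * \<psi> x)"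
    using assms \<psi> by (simp add: LINT_eq_integral L2_on_absolutely_integrable)
qed

lemma has_weak_deriv_0: "f \<in> L2_on a b \<Longrightarrow> has_weak_deriv 0 a b f f"
  by (rule has_weak_derivI) auto

lemma integral_test_function_by_parts:
  fixes f f' :: "real \<Rightarrow> real"
  assumes ab: "a \<le> b"
    and f: "\<And>x. x \<in> {a..b} \<Longrightarrow> (f has_vector_derivative f' x) (at x within {a..b})"
    and f': "continuous_on {a..b} f'" and \<psi>: "\<psi> \<in> test_functions a b"
  shows "integral {a..b} (\<lambda>x. f x * deriv \<psi> x) = - integral {a..b} (\<lambda>x. f' x * \<psi> x)"
proof -
  have fc: "continuous_on {a..b} f"
    using f has_vector_derivative_continuous continuous_on_eq_continuous_within by blast
  have d\<psi>: "(\<psi> has_real_derivative deriv \<psi> x) (at x)" for x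
    using test_functions_funpow_derivative[OF \<psi>, of 0] by simp
  have c\<psi>: "continuous_on {a..b} \<psi>" "continuous_on {a..b} (deriv \<psi>)"
    using test_functions_continuous_on[OF \<psi>, of _ 0] test_functions_continuous_on[OF \<psi>, of _ "Suc 0"]
    by auto
  have "((\<lambda>x. f x * deriv \<psi> x + f' x * \<psi> x) has_integral f b * \<psi> b - f a * \<psi> a) {a..b}"
  proof (rule fundamental_theorem_of_calculus[OF ab])
    fix x assume "x \<in> {a..b}"
    then show "((\<lambda>x. f x * \<psi> x) has_vector_derivative f x * deriv \<psi> x + f' x * \<psi> x) (at x within {a..b})"
      using DERIV_mult'[of f "f' x" x "{a..b}" \<psi> "deriv \<psi> x"] f has_field_derivative_at_within[OF d\<psi>]
      by (simp add: has_real_derivative_iff_has_vector_derivative add.commute)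
  qed
  then have "integral {a..b} (\<lambda>x. f x * deriv \<psi> x + f' x * \<psi> x) = 0"
    using test_functions_zero[OF \<psi>] by (simp add: integral_unique)
  moreover have "integral {a..b} (\<lambda>x. f x * deriv \<psi> x + f' x * \<psi> x)
      = integral {a..b} (\<lambda>x. f x * deriv \<psi> x) + integral {a..b} (\<lambda>x. f' x * \<psi> x)"
    by (intro integral_add integrable_continuous_real continuous_intros fc f' c\<psi>)
  ultimately show ?thesis by simp
qed

text \<open>The outermost of the \<open>Suc k\<close> derivatives on the test function is moved to
  \<open>f\<close>, since \<open>(deriv ^^ k) \<psi>\<close> is a test function too. Both directions
  are needed: upwards to find the weak derivatives of \<open>seed_operator\<close>, downwards to
  reduce the third weak derivative of a seed function to a first one.\<close>

lemma has_weak_deriv_Suc_iff: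
  fixes f f' :: "real \<Rightarrow> real"
  assumes ab: "a \<le> b"
    and f: "\<And>x. x \<in> {a..b} \<Longrightarrow> (f has_vector_derivative f' x) (at x within {a..b})"
    and f': "continuous_on {a..b} f'"
  shows "has_weak_deriv (Suc k) a b f g \<longleftrightarrow> has_weak_deriv k a b f' g"
proof -
  have "continuous_on {a..b} f"
    using f has_vector_derivative_continuous continuous_on_eq_continuous_within by blast
  then have L2: "f \<in> L2_on a b" "f' \<in> L2_on a b"
    using f' by (auto intro: continuous_on_L2_on)
  have eq: "integral {a..b} (\<lambda>x. f x * (deriv ^^ Suc k) \<psi> x)
      = - integral {a..b} (\<lambda>x. f' x * (deriv ^^ k) \<psi> x)" if "\<psi> \<in> test_functions a b" for \<psi>
    using integral_test_function_by_parts[OF ab f f' test_functions_funpow_deriv[OF that, of k]]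
    by simp
  show ?thesis
  proof
    assume h: "has_weak_deriv (Suc k) a b f g"
    show "has_weak_deriv k a b f' g"
    proof (rule has_weak_derivI)
      show "g \<in> L2_on a b" using h by (simp add: has_weak_deriv_def)
      show "integral {a..b} (\<lambda>x. f' x * (deriv ^^ k) \<psi> x) = (-1) ^ k * integral {a..b} (\<lambda>x. g x * \<psi> x)"
        if "\<psi> \<in> test_functions a b" for \<psi>
        using has_weak_deriv_integral[OF h that] eq[OF that] by simp
    qed (fact L2)
  next
    assume h: "has_weak_deriv k a b f' g"
    show "has_weak_deriv (Suc k) a b f g"
    proof (rule has_weak_derivI)
      show "g \<in> L2_on a b" using h by (simp add: has_weak_deriv_def)
      show "integral {a..b} (\<lambda>x. f x * (deriv ^^ Suc k) \<psi> x)
          = (-1) ^ Suc k * integral {a..b} (\<lambda>x. g x * \<psi> x)"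
        if "\<psi> \<in> test_functions a b" for \<psi>
        using has_weak_deriv_integral[OF h that] eq[OF that] by simp
    qed (fact L2)
  qed
qed

text \<open>Integration by parts with \<open>\<psi>\<close> as primitive of
  \<open>deriv \<psi>\<close> leaves only the integral of \<open>- (\<nu> t * \<psi> t)\<close>,
  because \<open>\<psi> b = 0\<close>; the constant \<open>c\<close> contributes nothing, as
  \<open>deriv \<psi>\<close> has integral 0.\<close>

lemma has_weak_deriv_indefinite_integral:
  fixes \<nu> :: "real \<Rightarrow> real"
  assumes ab: "a \<le> b" and \<nu>: "\<nu> \<in> L2_on a b"
  shows "has_weak_deriv (Suc 0) a b (\<lambda>x. c + integral {a..x} \<nu>) \<nu>"
proof (rule has_weak_derivI)
  have ai: "\<nu> absolutely_integrable_on {a..b}" using \<nu> by (rule L2_on_absolutely_integrable)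
  then have i: "\<nu> integrable_on {a..b}" by (simp add: absolutely_integrable_on_def)
  show "(\<lambda>x. c + integral {a..x} \<nu>) \<in> L2_on a b"
    by (intro continuous_on_L2_on continuous_intros indefinite_integral_continuous_1 i)
  fix \<psi> assume \<psi>: "\<psi> \<in> test_functions a b"
  have d: "(\<psi> has_vector_derivative deriv \<psi> x) (at x within {a..b})" for x
    using has_field_derivative_at_within[OF test_functions_funpow_derivative[OF \<psi>, of 0]]
    by (simp add: has_real_derivative_iff_has_vector_derivative)
  have c: "continuous_on {a..b} (deriv \<psi>)"
    using test_functions_continuous_on[OF \<psi>, of _ "Suc 0"] by simp
  have z: "\<psi> a = 0" "\<psi> b = 0" using test_functions_zero[OF \<psi>] by auto
  have "(deriv \<psi> has_integral 0) {a..b}"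
    using fundamental_theorem_of_calculus[OF ab, of \<psi> "deriv \<psi>"] d z by simp
  from has_integral_add[OF has_integral_mult_right[OF this, of c]
      integration_by_parts_indefinite_integral[OF ab ai d c]]
  have "((\<lambda>x. (c + integral {a..x} \<nu>) * deriv \<psi> x) has_integral integral {a..b} (\<lambda>t. - (\<nu> t * \<psi> t))) {a..b}"
    by (simp add: z algebra_simps)
  then show "integral {a..b} (\<lambda>x. (c + integral {a..x} \<nu>) * (deriv ^^ Suc 0) \<psi> x)
      = (-1) ^ Suc 0 * integral {a..b} (\<lambda>x. \<nu> x * \<psi> x)"
    by (simp add: integral_unique)
qed (fact \<nu>)

lemma has_weak_deriv_unique_primitive:
  fixes w1 w2 :: "real \<Rightarrow> real"
  assumes ab: "a < b" and w: "continuous_on {a..b} w1" "continuous_on {a..b} w2"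
    and h: "has_weak_deriv (Suc 0) a b w1 g" "has_weak_deriv (Suc 0) a b w2 g"
  shows "\<exists>c. \<forall>x\<in>{a..b}. w1 x - w2 x = c"
proof (rule du_Bois_Reymond[OF ab])
  show "continuous_on {a..b} (\<lambda>x. w1 x - w2 x)" by (intro continuous_intros w)
  fix \<psi> assume \<psi>: "\<psi> \<in> test_functions a b"
  have c: "continuous_on {a..b} (deriv \<psi>)"
    using test_functions_continuous_on[OF \<psi>, of _ "Suc 0"] by simp
  have "integral {a..b} (\<lambda>x. (w1 x - w2 x) * deriv \<psi> x)
      = integral {a..b} (\<lambda>x. w1 x * deriv \<psi> x) - integral {a..b} (\<lambda>x. w2 x * deriv \<psi> x)"
    unfolding left_diff_distrib
    by (intro integral_diff integrable_continuous_real continuous_intros w c)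
  then show "integral {a..b} (\<lambda>x. (w1 x - w2 x) * deriv \<psi> x) = 0"
    using has_weak_deriv_integral[OF h(1) \<psi>] has_weak_deriv_integral[OF h(2) \<psi>] by simp
qed

text \<open>Subtracting the expected Taylor polynomial leaves a function with derivative 0. This is
  done for \<open>u'\<close> first, and the resulting formula for \<open>u'\<close> is then used for
  \<open>u\<close>.\<close>

lemma constant_second_derivative:
  fixes u u' :: "real \<Rightarrow> real"
  assumes u: "\<And>x. x \<in> {a..b} \<Longrightarrow> (u has_vector_derivative u' x) (at x within {a..b})"
    and u': "\<And>x. x \<in> {a..b} \<Longrightarrow> (u' has_vector_derivative c) (at x within {a..b})"
    and x: "x \<in> {a..b}"
  shows "u' x = u' a + c * (x - a)" and "u x = u a + u' a * (x - a) + c / 2 * (x - a)\<^sup>2"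
proof -
  have const: "h x = h a" if x: "x \<in> {a..b}"
    and h: "\<And>x. x \<in> {a..b} \<Longrightarrow> (h has_real_derivative 0) (at x within {a..b})" for h :: "real \<Rightarrow> real" and x
  proof -
    obtain e where "\<And>x. x \<in> {a..b} \<Longrightarrow> h x = e"
      using has_field_derivative_zero_constant[OF _ h] by auto
    then show ?thesis using x by simp
  qed
  note u = u[folded has_real_derivative_iff_has_vector_derivative]
    and u' = u'[folded has_real_derivative_iff_has_vector_derivative]
  have du': "((\<lambda>x. u' x - c * (x - a)) has_real_derivative 0) (at x within {a..b})"
    if "x \<in> {a..b}" for x
    by (rule derivative_eq_intros u'[OF that] refl | simp)+
  have 1: "u' x = u' a + c * (x - a)" if "x \<in> {a..b}" for x
    using const[OF that du'] by simp
  show "u' x = u' a + c * (x - a)" using 1[OF x] .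
  have "((\<lambda>x. u x - u' a * (x - a) - c / 2 * (x - a)\<^sup>2) has_real_derivative 0) (at x within {a..b})"
    if "x \<in> {a..b}" for x
    by (rule derivative_eq_intros u[OF that] refl | simp add: 1[OF that])+
  from const[OF x this]
  show "u x = u a + u' a * (x - a) + c / 2 * (x - a)\<^sup>2" by simp
qed

section \<open>The seed operator\<close>

lemma integral_indefinite_integral:
  fixes g :: "real \<Rightarrow> real"
  assumes g: "g absolutely_integrable_on {a..x}" and x: "a \<le> x"
  shows "integral {a..x} (\<lambda>t. integral {a..t} g) = integral {a..x} (\<lambda>t. (x - t) * g t)"
proof -
  \<comment> \<open>Integration by parts with the constant 1 as \<open>p\<close> and the identity as
    its primitive.\<close>
  have "((\<lambda>t. integral {a..t} g * 1) has_integral integral {a..x} (\<lambda>t. g t * (x - t))) {a..x}"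
    by (rule integration_by_parts_indefinite_integral[OF x g]) (auto intro!: derivative_eq_intros)
  then show ?thesis by (simp add: integral_unique mult.commute)
qed

lemma integral_indefinite_integral_twice:
  fixes g :: "real \<Rightarrow> real"
  assumes g: "g absolutely_integrable_on {a..x}" and x: "a \<le> x"
  shows "integral {a..x} (\<lambda>t. integral {a..t} (\<lambda>s. integral {a..s} g))
    = integral {a..x} (\<lambda>t. (x - t)\<^sup>2 / 2 * g t)"
proof -
  have "g integrable_on {a..x}" using g by (simp add: absolutely_integrable_on_def)
  then have "(\<lambda>s. integral {a..s} g) absolutely_integrable_on {a..x}"
    by (intro absolutely_integrable_continuous_real indefinite_integral_continuous_1)
  then have "integral {a..x} (\<lambda>t. integral {a..t} (\<lambda>s. integral {a..s} g))
      = integral {a..x} (\<lambda>t. (x - t) * integral {a..t} g)"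
    using x by (rule integral_indefinite_integral)
  \<comment> \<open>A second integration by parts, now with primitive
    \<open>- (x - t)\<^sup>2 / 2\<close> of \<open>x - t\<close>. Its value at the end point
    \<open>x\<close> is 0, written out to fit the pattern \<open>P b - P t\<close>.\<close>
  moreover have "((\<lambda>t. integral {a..t} g * (x - t)) has_integral
      integral {a..x} (\<lambda>t. g t * (- (x - x)\<^sup>2 / 2 - - (x - t)\<^sup>2 / 2))) {a..x}"
  proof (rule integration_by_parts_indefinite_integral[OF x g])
    show "((\<lambda>t. - (x - t)\<^sup>2 / 2) has_vector_derivative x - y) (at y within {a..x})" for y
      unfolding has_real_derivative_iff_has_vector_derivative[symmetric]
      by (auto intro!: derivative_eq_intros simp: field_simps)
  qed (intro continuous_intros)
  ultimately show ?thesis by (simp add: integral_unique mult.commute)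
qed

text \<open>For fixed \<open>x\<close> the kernel is a quadratic polynomial in \<eta> without
  constant term, so its integral depends on \<nu> only through the moments \<open>M1\<close> and
  \<open>M2\<close>. Collecting powers of \<open>x + \<tau>s\<close> gives the polynomial part; the
  last integral is a threefold primitive by Cauchy's formula.\<close>

lemma seed_operator_eq:
  fixes d \<tau>0 \<tau>s :: real
  assumes \<tau>s: "\<tau>s > 0" and d: "d < 1" and \<nu>: "\<nu> \<in> L2_on (- \<tau>s) 0" and x: "x \<in> {- \<tau>s..0}"
  defines "M1 \<equiv> integral {- \<tau>s..0} (\<lambda>\<eta>. \<eta> * \<nu> \<eta>)" and "M2 \<equiv> integral {- \<tau>s..0} (\<lambda>\<eta>. \<eta>\<^sup>2 * \<nu> \<eta>)"
  shows "seed_operator d \<tau>0 \<tau>s \<nu> x =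
    - \<tau>0 + (\<tau>0 * 2 * (1 - d) / ((2 - d) * \<tau>s) - (1 - d) / (2 - d) * (M1 + M2 / \<tau>s)) * (x + \<tau>s)
    + (\<tau>0 * d / ((2 - d) * \<tau>s\<^sup>2) + (1 - d) / ((2 - d) * \<tau>s) * M1 - d / (2 * (2 - d) * \<tau>s\<^sup>2) * M2) * (x + \<tau>s)\<^sup>2
    + integral {- \<tau>s..x} (\<lambda>t. integral {- \<tau>s..t} (\<lambda>s. integral {- \<tau>s..s} \<nu>))"
proof -
  have ai: "\<nu> absolutely_integrable_on {- \<tau>s..0}" using \<nu> by (rule L2_on_absolutely_integrable)
  have aix: "\<nu> absolutely_integrable_on {- \<tau>s..x}"
    using ai by (rule set_integrable_subset) (use x in auto)
  \<comment> \<open>\<open>c1\<close> and \<open>c2\<close> are the coefficients of \<eta> and of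
    its square in the kernel.\<close>
  define c1 where "c1 = (1 - d) / (2 - d) * (- (x + \<tau>s) + (x + \<tau>s)\<^sup>2 / \<tau>s)"
  define c2 where "c2 = - (1 - d) / ((2 - d) * \<tau>s) * (x + \<tau>s) - d / (2 * (2 - d) * \<tau>s\<^sup>2) * (x + \<tau>s)\<^sup>2"
  have "(LINT \<eta>:{- \<tau>s..0}|lebesgue. seed_kernel d \<tau>s x \<eta> * \<nu> \<eta>)
      = (LINT \<eta>:{- \<tau>s..0}|lebesgue. \<nu> \<eta> * seed_kernel d \<tau>s x \<eta>)"
    by (simp add: mult.commute)
  also have "\<dots> = integral {- \<tau>s..0} (\<lambda>\<eta>. \<nu> \<eta> * seed_kernel d \<tau>s x \<eta>)"
    using ai by (rule LINT_eq_integral) (use \<tau>s d in \<open>auto simp: seed_kernel_def intro!: continuous_intros\<close>)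
  also have "\<dots> = integral {- \<tau>s..0} (\<lambda>\<eta>. c1 * (\<eta> * \<nu> \<eta>) + c2 * (\<eta>\<^sup>2 * \<nu> \<eta>))"
  proof -
    have "seed_kernel d \<tau>s x \<eta> = c1 * \<eta> + c2 * \<eta>\<^sup>2" for \<eta>
      using \<tau>s d unfolding seed_kernel_def c1_def c2_def
      by (simp add: divide_simps) (simp add: algebra_simps power2_eq_square)
    then show ?thesis by (simp add: algebra_simps)
  qed
  also have "\<dots> = c1 * M1 + c2 * M2"
  proof -
    have "(\<lambda>\<eta>. \<nu> \<eta> * \<eta>) integrable_on {- \<tau>s..0}" "(\<lambda>\<eta>. \<nu> \<eta> * \<eta>\<^sup>2) integrable_on {- \<tau>s..0}"
      by (intro set_lebesgue_integral_eq_integral(1) absolutely_integrable_mult_continuous[OF ai]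
          continuous_intros)+
    then have "(\<lambda>\<eta>. \<eta> * \<nu> \<eta>) integrable_on {- \<tau>s..0}" "(\<lambda>\<eta>. \<eta>\<^sup>2 * \<nu> \<eta>) integrable_on {- \<tau>s..0}"
      by (simp_all add: mult.commute)
    then show ?thesis
      by (simp add: integral_add integrable_on_mult_right M1_def M2_def)
  qed
  finally have K: "(LINT \<eta>:{- \<tau>s..0}|lebesgue. seed_kernel d \<tau>s x \<eta> * \<nu> \<eta>) = c1 * M1 + c2 * M2" .
  have "(LINT \<eta>:{- \<tau>s..x}|lebesgue. (x - \<eta>)\<^sup>2 / 2 * \<nu> \<eta>)
      = (LINT \<eta>:{- \<tau>s..x}|lebesgue. \<nu> \<eta> * ((x - \<eta>)\<^sup>2 / 2))"
    by (simp add: mult.commute)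
  also have "\<dots> = integral {- \<tau>s..x} (\<lambda>\<eta>. \<nu> \<eta> * ((x - \<eta>)\<^sup>2 / 2))"
    using aix by (rule LINT_eq_integral) (auto intro!: continuous_intros)
  also have "\<dots> = integral {- \<tau>s..x} (\<lambda>t. integral {- \<tau>s..t} (\<lambda>s. integral {- \<tau>s..s} \<nu>))"
    using integral_indefinite_integral_twice[OF aix] x by (simp add: mult.commute)
  finally show ?thesis
    unfolding seed_operator_def K seed_beta_def c1_def c2_def
    using \<tau>s d by (simp add: divide_simps) (simp add: algebra_simps power2_eq_square)
qed

text \<open>At the left end the iterated integrals vanish, and at 0 Cauchy's formula expresses them
  by the same moments that occur in the coefficients \<open>A\<close> and \<open>B\<close>. The
  boundary conditions thus become algebraic identities in \<open>M1\<close> and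
  \<open>M2\<close>.\<close>

lemma seed_operator_derivatives:
  fixes d \<tau>0 \<tau>s :: real
  assumes \<tau>s: "\<tau>s > 0" and d: "d < 1" and \<nu>: "\<nu> \<in> L2_on (- \<tau>s) 0"
  obtains T' c where
    "\<And>x. x \<in> {- \<tau>s..0} \<Longrightarrow>
      (seed_operator d \<tau>0 \<tau>s \<nu> has_vector_derivative T' x) (at x within {- \<tau>s..0})"
    "\<And>x. x \<in> {- \<tau>s..0} \<Longrightarrow>
      (T' has_vector_derivative c + integral {- \<tau>s..x} \<nu>) (at x within {- \<tau>s..0})"
    "seed_operator d \<tau>0 \<tau>s \<nu> 0 = 0" "seed_operator d \<tau>0 \<tau>s \<nu> (- \<tau>s) = - \<tau>0"
    "T' 0 = T' (- \<tau>s) / (1 - d)"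
proof -
  have ai: "\<nu> absolutely_integrable_on {- \<tau>s..0}" using \<nu> by (rule L2_on_absolutely_integrable)
  define M1 M2 where "M1 = integral {- \<tau>s..0} (\<lambda>\<eta>. \<eta> * \<nu> \<eta>)" and "M2 = integral {- \<tau>s..0} (\<lambda>\<eta>. \<eta>\<^sup>2 * \<nu> \<eta>)"
  define A B where "A = \<tau>0 * 2 * (1 - d) / ((2 - d) * \<tau>s) - (1 - d) / (2 - d) * (M1 + M2 / \<tau>s)"
    and "B = \<tau>0 * d / ((2 - d) * \<tau>s\<^sup>2) + (1 - d) / ((2 - d) * \<tau>s) * M1 - d / (2 * (2 - d) * \<tau>s\<^sup>2) * M2"
  define V1 V2 V3 where "V1 = (\<lambda>x. integral {- \<tau>s..x} \<nu>)" and "V2 = (\<lambda>x. integral {- \<tau>s..x} V1)"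
    and "V3 = (\<lambda>x. integral {- \<tau>s..x} V2)"
  have T: "seed_operator d \<tau>0 \<tau>s \<nu> x = - \<tau>0 + A * (x + \<tau>s) + B * (x + \<tau>s)\<^sup>2 + V3 x"
    if "x \<in> {- \<tau>s..0}" for x
    using seed_operator_eq[OF \<tau>s d \<nu> that, of \<tau>0]
    by (simp add: A_def B_def M1_def M2_def V1_def V2_def V3_def)
  have V1: "continuous_on {- \<tau>s..0} V1"
    unfolding V1_def using ai
    by (intro indefinite_integral_continuous_1) (simp add: absolutely_integrable_on_def)
  have dV2: "(V2 has_real_derivative V1 x) (at x within {- \<tau>s..0})" if "x \<in> {- \<tau>s..0}" for x
    unfolding V2_def has_real_derivative_iff_has_vector_derivative
    using V1 that by (rule integral_has_vector_derivative)
  then have V2: "continuous_on {- \<tau>s..0} V2" by (rule DERIV_continuous_on)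
  have dV3: "(V3 has_real_derivative V2 x) (at x within {- \<tau>s..0})" if "x \<in> {- \<tau>s..0}" for x
    unfolding V3_def has_real_derivative_iff_has_vector_derivative
    using V2 that by (rule integral_has_vector_derivative)
  have V20: "V2 0 = - M1"
    using integral_indefinite_integral[OF ai] \<tau>s by (simp add: V1_def V2_def M1_def)
  have V30: "V3 0 = M2 / 2"
    using integral_indefinite_integral_twice[OF ai] \<tau>s by (simp add: V1_def V2_def V3_def M2_def)
  have Va: "V2 (- \<tau>s) = 0" "V3 (- \<tau>s) = 0" by (simp_all add: V2_def V3_def)
  define T' where "T' = (\<lambda>x. A + 2 * B * (x + \<tau>s) + V2 x)"
  show ?thesis
  proof
    fix x assume x: "x \<in> {- \<tau>s..0}"
    have "((\<lambda>x. - \<tau>0 + A * (x + \<tau>s) + B * (x + \<tau>s)\<^sup>2 + V3 x) has_real_derivative T' x) (at x within {- \<tau>s..0})"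
      unfolding T'_def by (rule derivative_eq_intros dV3[OF x] refl | simp)+
    then show "(seed_operator d \<tau>0 \<tau>s \<nu> has_vector_derivative T' x) (at x within {- \<tau>s..0})"
      unfolding has_real_derivative_iff_has_vector_derivative
      by (rule has_vector_derivative_transform[OF x, rotated]) (rule T)
    have "(T' has_real_derivative 2 * B + integral {- \<tau>s..x} \<nu>) (at x within {- \<tau>s..0})"
      unfolding T'_def by (rule derivative_eq_intros dV2[OF x] refl | simp add: V1_def)+
    then show "(T' has_vector_derivative 2 * B + integral {- \<tau>s..x} \<nu>) (at x within {- \<tau>s..0})"
      unfolding has_real_derivative_iff_has_vector_derivative .
  next
    show "seed_operator d \<tau>0 \<tau>s \<nu> 0 = 0"
      using \<tau>s d by (simp add: T V30 A_def B_def divide_simps) (simp add: algebra_simps power2_eq_square)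
    show "seed_operator d \<tau>0 \<tau>s \<nu> (- \<tau>s) = - \<tau>0"
      using \<tau>s by (simp add: T Va)
    show "T' 0 = T' (- \<tau>s) / (1 - d)"
      using \<tau>s d by (simp add: T'_def V20 Va A_def B_def divide_simps) (simp add: algebra_simps power2_eq_square)
  qed
qed

lemma
  fixes d \<tau>0 \<tau>s :: real
  assumes \<tau>s: "\<tau>s > 0" and d: "d < 1" and \<nu>: "\<nu> \<in> L2_on (- \<tau>s) 0"
  shows seed_operator_in_seed_functions: "seed_operator d \<tau>0 \<tau>s \<nu> \<in> seed_functions d \<tau>0 \<tau>s"
    and seed_operator_has_weak_deriv: "has_weak_deriv 3 (- \<tau>s) 0 (seed_operator d \<tau>0 \<tau>s \<nu>) \<nu>"
proof -
  let ?T = "seed_operator d \<tau>0 \<tau>s \<nu>"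
  obtain T' c where
    T: "\<And>x. x \<in> {- \<tau>s..0} \<Longrightarrow> (?T has_vector_derivative T' x) (at x within {- \<tau>s..0})"
    and T': "\<And>x. x \<in> {- \<tau>s..0} \<Longrightarrow>
      (T' has_vector_derivative c + integral {- \<tau>s..x} \<nu>) (at x within {- \<tau>s..0})"
    and bc: "?T 0 = 0" "?T (- \<tau>s) = - \<tau>0" "T' 0 = T' (- \<tau>s) / (1 - d)"
    using seed_operator_derivatives[OF assms, of \<tau>0] by blast
  let ?T'' = "\<lambda>x. c + integral {- \<tau>s..x} \<nu>"
  have "\<nu> integrable_on {- \<tau>s..0}"
    using L2_on_absolutely_integrable[OF \<nu>] by (simp add: absolutely_integrable_on_def)
  then have cT'': "continuous_on {- \<tau>s..0} ?T''"
    by (intro continuous_intros indefinite_integral_continuous_1)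
  have cT': "continuous_on {- \<tau>s..0} T'" and cT: "continuous_on {- \<tau>s..0} ?T"
    using T T' has_vector_derivative_continuous continuous_on_eq_continuous_within by blast+
  have le: "- \<tau>s \<le> 0" using \<tau>s by simp
  note lift = has_weak_deriv_Suc_iff[OF le, THEN iffD2]
  have w0: "has_weak_deriv 0 (- \<tau>s) 0 ?T ?T"
    by (intro has_weak_deriv_0 continuous_on_L2_on cT)
  have w1: "has_weak_deriv (Suc 0) (- \<tau>s) 0 ?T T'"
    by (rule lift[OF T cT']) (auto intro: has_weak_deriv_0 continuous_on_L2_on cT')
  have w2: "has_weak_deriv (Suc (Suc 0)) (- \<tau>s) 0 ?T ?T''"
    by (rule lift[OF T cT'], assumption, rule lift[OF T' cT''])
      (auto intro: has_weak_deriv_0 continuous_on_L2_on cT'')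
  \<comment> \<open>The ascent starts from \<nu> as first weak derivative of \<open>?T''\<close>;
    each use of \<open>lift\<close> passes to a primitive and raises the order by one.\<close>
  have w3: "has_weak_deriv (Suc (Suc (Suc 0))) (- \<tau>s) 0 ?T \<nu>"
    by (rule lift[OF T cT'], assumption, rule lift[OF T' cT''], assumption)
      (rule has_weak_deriv_indefinite_integral[OF le \<nu>])
  then show "has_weak_deriv 3 (- \<tau>s) 0 ?T \<nu>" by (simp add: eval_nat_numeral)
  have "\<exists>g. has_weak_deriv j (- \<tau>s) 0 ?T g" if "j \<le> 3" for j
  proof -
    consider "j = 0" | "j = Suc 0" | "j = Suc (Suc 0)" | "j = Suc (Suc (Suc 0))"
      using \<open>j \<le> 3\<close> by linarith
    then show ?thesis by cases (use w0 w1 w2 w3 in blast)+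
  qed
  then have "?T \<in> sobolev 3 (- \<tau>s) 0"
    by (auto simp: sobolev_def continuous_on_L2_on[OF cT])
  moreover have "?T \<in> C2_on (- \<tau>s) 0"
    using \<tau>s T T' cT'' by (intro C2_onI) auto
  moreover have "deriv_on (- \<tau>s) 0 ?T x = T' x" if "x \<in> {- \<tau>s..0}" for x
    using \<tau>s that T[OF that] by (intro deriv_on_eq) auto
  ultimately show "?T \<in> seed_functions d \<tau>0 \<tau>s"
    using bc \<tau>s by (simp add: seed_functions_def)
qed

text \<open>Equality holds at every point, not just almost everywhere, because both sides are C^2
  representatives. Any representative \<open>g\<close> will do.\<close>

lemma seed_operator_third_derivative:
  fixes d \<tau>0 \<tau>s :: real
  assumes \<tau>s: "\<tau>s > 0" and d: "d < 1" and \<phi>: "\<phi> \<in> seed_functions d \<tau>0 \<tau>s"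
    and g: "has_weak_deriv 3 (- \<tau>s) 0 \<phi> g" and x: "x \<in> {- \<tau>s..0}"
  shows "seed_operator d \<tau>0 \<tau>s g x = \<phi> x"
proof -
  let ?T = "seed_operator d \<tau>0 \<tau>s g" and ?D = "deriv_on (- \<tau>s) 0"
  have le: "- \<tau>s \<le> 0" and less: "- \<tau>s < 0" using \<tau>s by auto
  have unique: "\<exists>c. \<forall>x\<in>{- \<tau>s..0}. ?D (?D \<phi>) x - ?D (?D ?T) x = c"
  proof (rule has_weak_deriv_unique_primitive[OF less])
    \<comment> \<open>Stated for an arbitrary seed function \<open>f\<close> with third weak
      derivative \<open>g\<close>, since it is applied both to \<phi> and to
      \<open>?T\<close>.\<close>
    have "continuous_on {- \<tau>s..0} (?D (?D f)) \<and> has_weak_deriv (Suc 0) (- \<tau>s) 0 (?D (?D f)) g"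
      if f: "f \<in> seed_functions d \<tau>0 \<tau>s" "has_weak_deriv 3 (- \<tau>s) 0 f g" for f
    proof -
      have C2: "f \<in> C2_on (- \<tau>s) 0" using f(1) by (simp add: seed_functions_def)
      then have c: "continuous_on {- \<tau>s..0} (?D (?D f))" "continuous_on {- \<tau>s..0} (?D f)"
        by (auto simp: C2_on_def intro: differentiable_imp_continuous_on)
      have "has_weak_deriv (Suc (Suc 0)) (- \<tau>s) 0 (?D f) g"
        using has_weak_deriv_Suc_iff[OF le C2_onD(1)[OF C2] c(2)] f(2) by (simp add: eval_nat_numeral)
      then show ?thesis
        using has_weak_deriv_Suc_iff[OF le C2_onD(2)[OF C2] c(1)] c(1) by simp
    qed
    note * = this
    have "g \<in> L2_on (- \<tau>s) 0" using g by (simp add: has_weak_deriv_def)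
    note ** = *[OF \<phi> g] *[OF seed_operator_in_seed_functions[OF \<tau>s d this]
        seed_operator_has_weak_deriv[OF \<tau>s d this]]
    show "continuous_on {- \<tau>s..0} (?D (?D \<phi>))" "continuous_on {- \<tau>s..0} (?D (?D ?T))"
      "has_weak_deriv (Suc 0) (- \<tau>s) 0 (?D (?D \<phi>)) g" "has_weak_deriv (Suc 0) (- \<tau>s) 0 (?D (?D ?T)) g"
      using ** by blast+
  qed
  then obtain c where c: "\<And>x. x \<in> {- \<tau>s..0} \<Longrightarrow> ?D (?D \<phi>) x - ?D (?D ?T) x = c" by blast
  have T: "?T \<in> seed_functions d \<tau>0 \<tau>s"
    using g by (intro seed_operator_in_seed_functions[OF \<tau>s d]) (simp add: has_weak_deriv_def)
  then have C2: "\<phi> \<in> C2_on (- \<tau>s) 0" "?T \<in> C2_on (- \<tau>s) 0"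
    using \<phi> by (auto simp: seed_functions_def)
  define u u' where "u = (\<lambda>x. \<phi> x - ?T x)" and "u' = (\<lambda>x. ?D \<phi> x - ?D ?T x)"
  have du: "(u has_vector_derivative u' x) (at x within {- \<tau>s..0})" if "x \<in> {- \<tau>s..0}" for x
    unfolding u_def u'_def
    by (intro has_vector_derivative_diff C2_onD(1)[OF C2(1) that] C2_onD(1)[OF C2(2) that])
  have du': "(u' has_vector_derivative c) (at x within {- \<tau>s..0})" if "x \<in> {- \<tau>s..0}" for x
    unfolding u'_def c[OF that, symmetric]
    by (intro has_vector_derivative_diff C2_onD(2)[OF C2(1) that] C2_onD(2)[OF C2(2) that])
  note taylor = constant_second_derivative[where u = u and u' = u', OF du du']
  \<comment> \<open>In the difference the value \<open>- \<tau>0\<close> cancels, and the slope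
    condition, being linear, is inherited.\<close>
  have bc: "u 0 = 0" "u (- \<tau>s) = 0" "u' 0 = u' (- \<tau>s) / (1 - d)"
    using T \<phi> by (simp_all add: u_def u'_def seed_functions_def diff_divide_distrib)
  have 0: "(0::real) \<in> {- \<tau>s..0}" using \<tau>s by simp
  have "u' (- \<tau>s) * \<tau>s + c / 2 * \<tau>s\<^sup>2 = 0"
    using taylor(2)[OF _ _ 0] bc by simp
  then have "\<tau>s * (u' (- \<tau>s) + c / 2 * \<tau>s) = 0" by (simp add: algebra_simps power2_eq_square)
  then have 1: "u' (- \<tau>s) = - (c / 2 * \<tau>s)" using \<tau>s by simp
  \<comment> \<open>The vanishing of \<open>u\<close> at both ends makes the two end slopes
    opposite, \<open>- (c / 2 * \<tau>s)\<close> and \<open>c / 2 * \<tau>s\<close>. The slope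
    condition then reads \<open>c * \<tau>s * (2 - d) = 0\<close>.\<close>
  have "u' (- \<tau>s) + c * \<tau>s = u' (- \<tau>s) / (1 - d)"
    using taylor(1)[OF _ _ 0] bc by simp
  then have "c * \<tau>s * (2 - d) = 0"
    using d unfolding 1 by (simp add: field_simps)
  then have "c = 0" using \<tau>s d by simp
  then have "u x = 0" using taylor(2)[OF _ _ x] bc 1 by simp
  then show ?thesis by (simp add: u_def)
qed

theorem theorem2:
  fixes d \<tau>0 \<tau>s :: real
  assumes "\<tau>s > 0" and "\<tau>0 > 0" and "d < 1"
  shows "(\<forall>\<phi>\<in>seed_functions d \<tau>0 \<tau>s. \<forall>g. has_weak_deriv 3 (- \<tau>s) 0 \<phi> g \<longrightarrow>
            (\<forall>x\<in>{- \<tau>s..0}. seed_operator d \<tau>0 \<tau>s g x = \<phi> x)) \<and>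
         (\<forall>\<nu>\<in>L2_on (- \<tau>s) 0. seed_operator d \<tau>0 \<tau>s \<nu> \<in> seed_functions d \<tau>0 \<tau>s) \<and>
         (\<forall>\<nu>\<in>L2_on (- \<tau>s) 0. has_weak_deriv 3 (- \<tau>s) 0 (seed_operator d \<tau>0 \<tau>s \<nu>) \<nu>)"
  using assms seed_operator_third_derivative seed_operator_in_seed_functions seed_operator_has_weak_deriv
  by blast

end
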